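(* Let $n\ge1$, let $\boldsymbol x=\{x_1,\dots,x_{2n}\}$ be distinct real points, and let $\boldsymbol\zeta=\{\zeta_1,\dots,\zeta_{n+1}\}\subset\widehat{\mathbb C}$ (distinct, and disjoint from $\boldsymbol x$) be closed under conjugation and solve the stationary relation $$\sum_{j=1}^{2n}\frac{1}{\zeta_k-x_j}=\sum_{l\neq k}\frac{2}{\zeta_k-\zeta_l},\qquad k=1,\dots,n+1.$$ Let $\boldsymbol\rho_j=\sum_{k\ne j}2\delta_{x_k}-\sum_{k=1}^{n+1}4\delta_{\zeta_k}$, $j=1,\dots,2n$. Under the $1/4$-superposition of the $\mathrm{SLE}(0,x_j,\boldsymbol\rho_j)$ processes, i.e. $\nu_j\equiv1/4$ for all $j$, the critical points $\boldsymbol x(t)=(x_1(t),\dots,x_{2n}(t))$ evolve as $$\ddot x_j=-\sum_{k\ne j}\frac{2}{(x_j-x_k)^3},\qquad j=1,\dots,2n.$$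
   Context: $\widehat{\mathbb C}$ is the Riemann sphere. One of the $\zeta_k$ may be $\infty$; any fraction whose denominator involves $\infty$ is $0$, and $g_t(\infty)=\infty$. The $1/4$-superposition of the $\mathrm{SLE}(0,x_j,\boldsymbol\rho_j)$ processes is the Loewner chain $$\partial_tg_t(z)=\sum_{j=1}^{2n}\frac{1/2}{g_t(z)-x_j(t)},\qquad g_0(z)=z,$$ where, with $\zeta_k(t)=g_t(\zeta_k)$, the driving functions solve $$\dot x_j=\frac14\Big(\sum_{k\ne j}\frac{2}{x_j-x_k}-\sum_{k=1}^{n+1}\frac{4}{x_j-\zeta_k(t)}\Big)+\sum_{k\ne j}\frac{1/2}{x_j-x_k},\qquad x_j(0)=x_j .$$ The evolution is considered up to the first collision among the points $x_j(t)$, $\zeta_k(t)$. *)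

theory Defs
  imports "HOL-Analysis.Analysis"
begin

text \<open>The Riemann sphere as the one-point compactification of the plane; the point at infinity is
  \<^term>\<open>None\<close>, as in the library's \<^const>\<open>Alexandroff_compactification\<close>.\<close>

type_synonym sphere = "complex option"

text \<open>The fraction \<open>c / (z - w)\<close>, which is \<open>0\<close> as soon as infinity occurs in the denominator.\<close>

fun sfrac :: "complex \<Rightarrow> sphere \<Rightarrow> sphere \<Rightarrow> complex" where
  "sfrac c (Some z) (Some w) = c / (z - w)"
| "sfrac c None w = 0"
| "sfrac c z None = 0"

text \<open>Loewner evolution with driving functions \<open>x j\<close> and constant speeds \<open>\<nu> j > 0\<close>, \<open>j \<in> J\<close>:
  \<open>\<gamma>\<close> is a solution started at \<open>z\<close> that survives (does not hit a driving function) up to and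
  including time \<open>t\<close>.\<close>

definition loewner_trajectory ::
  "nat set \<Rightarrow> (nat \<Rightarrow> real) \<Rightarrow> (nat \<Rightarrow> real \<Rightarrow> real) \<Rightarrow> complex \<Rightarrow> real \<Rightarrow> (real \<Rightarrow> complex) \<Rightarrow> bool" where
  "loewner_trajectory J \<nu> x z t \<gamma> \<longleftrightarrow>
     \<gamma> 0 = z \<and>
     (\<forall>s\<in>{0..t}. \<forall>j\<in>J. \<gamma> s \<noteq> of_real (x j s)) \<and>
     (\<forall>s\<in>{0..t}. (\<gamma> has_vector_derivative
        (\<Sum>j\<in>J. of_real (2 * \<nu> j) / (\<gamma> s - of_real (x j s)))) (at s within {0..t}))"

definition loewner_hull ::
  "nat set \<Rightarrow> (nat \<Rightarrow> real) \<Rightarrow> (nat \<Rightarrow> real \<Rightarrow> real) \<Rightarrow> real \<Rightarrow> complex set" where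
  "loewner_hull J \<nu> x t = {z. \<nexists>\<gamma>. loewner_trajectory J \<nu> x z t \<gamma>}"

text \<open>The map \<open>g t\<close> is only constrained off the hull at time \<open>t\<close>. Its extension to the sphere is
  \<^term>\<open>map_option (g t)\<close>, which fixes infinity.\<close>

definition loewner_chain ::
  "nat set \<Rightarrow> (nat \<Rightarrow> real) \<Rightarrow> (nat \<Rightarrow> real \<Rightarrow> real) \<Rightarrow> real \<Rightarrow> (real \<Rightarrow> complex \<Rightarrow> complex) \<Rightarrow> bool" where
  "loewner_chain J \<nu> x T g \<longleftrightarrow>
     (\<forall>t\<in>{0..<T}. \<forall>z. z \<notin> loewner_hull J \<nu> x t \<longrightarrow> loewner_trajectory J \<nu> x z t (\<lambda>s. g s z))"

text \<open>No two of the points \<open>x j t\<close> (\<open>j \<in> J\<close>) and \<open>\<zeta> k\<close> transported by \<open>g t\<close> (\<open>k \<in> K\<close>) collide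
  before time \<open>T\<close>; in particular no \<open>\<zeta> k\<close> is swallowed by the hull.\<close>

definition no_collision_before ::
  "nat set \<Rightarrow> nat set \<Rightarrow> (nat \<Rightarrow> real) \<Rightarrow> (nat \<Rightarrow> sphere) \<Rightarrow> real \<Rightarrow>
   (nat \<Rightarrow> real \<Rightarrow> real) \<Rightarrow> (real \<Rightarrow> complex \<Rightarrow> complex) \<Rightarrow> bool" where
  "no_collision_before J K \<nu> \<zeta> T x g \<longleftrightarrow>
     (\<forall>t\<in>{0..<T}.
        inj_on (\<lambda>j. x j t) J \<and>
        (\<forall>k\<in>K. \<forall>z. \<zeta> k = Some z \<longrightarrow> z \<notin> loewner_hull J \<nu> x t) \<and>
        inj_on (\<lambda>k. map_option (g t) (\<zeta> k)) K \<and>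
        (\<forall>j\<in>J. \<forall>k\<in>K. map_option (g t) (\<zeta> k) \<noteq> Some (of_real (x j t))))"

text \<open>The \<open>\<nu>\<close>-superposition, \<open>\<nu> j > 0\<close>, of the processes \<open>SLE(0, x\<^sub>j, \<rho>\<^sub>j)\<close> on \<open>[0, T)\<close>, started from
  the points \<open>x0 j\<close>. The divisor \<open>\<rho>\<^sub>j\<close> is given by its weights:
  \<open>\<rho>\<^sub>j = (\<Sum>k\<in>J-{j}. a j k \<delta>\<^bsub>x0 k\<^esub>) + (\<Sum>k\<in>K. b j k \<delta>\<^bsub>\<zeta> k\<^esub>)\<close>.
  The drift of \<open>x j\<close> is a complex number a priori, so the driving equation is stated in the complex
  plane, for the real-valued \<open>x j\<close>.\<close>

definition sle0_superposition ::
  "nat set \<Rightarrow> nat set \<Rightarrow> (nat \<Rightarrow> real) \<Rightarrow> (nat \<Rightarrow> real) \<Rightarrow> (nat \<Rightarrow> sphere) \<Rightarrow>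
   (nat \<Rightarrow> nat \<Rightarrow> real) \<Rightarrow> (nat \<Rightarrow> nat \<Rightarrow> real) \<Rightarrow> real \<Rightarrow>
   (nat \<Rightarrow> real \<Rightarrow> real) \<Rightarrow> (real \<Rightarrow> complex \<Rightarrow> complex) \<Rightarrow> bool" where
  "sle0_superposition J K \<nu> x0 \<zeta> a b T x g \<longleftrightarrow>
     loewner_chain J \<nu> x T g \<and>
     (\<forall>j\<in>J. x j 0 = x0 j) \<and>
     (\<forall>j\<in>J. \<forall>t\<in>{0..<T}.
        ((\<lambda>s. complex_of_real (x j s)) has_vector_derivative
           (of_real (\<nu> j) *
              ((\<Sum>k\<in>J - {j}. of_real (a j k) / (of_real (x j t) - of_real (x k t))) +
               (\<Sum>k\<in>K. sfrac (of_real (b j k)) (Some (of_real (x j t))) (map_option (g t) (\<zeta> k)))) +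
            (\<Sum>k\<in>J - {j}. of_real (2 * \<nu> k) / (of_real (x j t) - of_real (x k t)))))
        (at t within {0..<T}))"

end

theory Submission
  imports Defs
begin

text \<open>Write \<open>A\<^sub>j = \<Sum>\<^bsub>k\<noteq>j\<^esub> 1/(x\<^sub>j - x\<^sub>k)\<close>, \<open>B\<^sub>j = \<Sum>\<^sub>k 1/(x\<^sub>j - \<zeta>\<^sub>k)\<close>, \<open>C\<^sub>k = \<Sum>\<^sub>j 1/(\<zeta>\<^sub>k - x\<^sub>j)\<close>,
  \<open>D\<^sub>k = \<Sum>\<^bsub>l\<noteq>k\<^esub> 1/(\<zeta>\<^sub>k - \<zeta>\<^sub>l)\<close>, with only the finite \<open>\<zeta>\<^sub>k\<close> contributing. The evolution is
  \<open>x\<^sub>j' = A\<^sub>j - B\<^sub>j\<close>, \<open>\<zeta>\<^sub>k' = C\<^sub>k / 2\<close>. Partial fractions show that the defect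
  \<open>E\<^sub>k = C\<^sub>k - 2 D\<^sub>k\<close> of the stationary relation satisfies the scalar linear equation
  \<open>E\<^sub>k' = (\<Sum>\<^sub>j 1/(\<zeta>\<^sub>k - x\<^sub>j)\<^sup>2) E\<^sub>k / 2\<close>, so that it vanishes for all times. Under stationarity the same
  identity, with the roles of \<open>x\<close> and \<open>\<zeta>\<close> exchanged, cancels every term of \<open>(A\<^sub>j - B\<^sub>j)'\<close> that
  involves a \<open>\<zeta>\<^sub>k\<close>.\<close>

section \<open>Partial fraction identities for one family of points\<close>

abbreviation pole_sum :: "'i set \<Rightarrow> ('i \<Rightarrow> 'a) \<Rightarrow> 'a::field \<Rightarrow> 'a" where
  "pole_sum S y w \<equiv> \<Sum>i\<in>S. 1 / (w - y i)"

text \<open>Partial fractions in \<open>u\<close> for \<open>1 / ((p - u)^2 (u - q))\<close>, summed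
  over \<open>u = y i\<close>. With \<open>a = p - u\<close> and \<open>b = u - q\<close> one has
  \<open>a + b = p - q\<close>, so each summand reduces to a rational identity in \<open>a\<close>
  and \<open>b\<close>.\<close>

lemma sum_double_pole_simple_pole:
  fixes y :: "'i \<Rightarrow> 'a::field"
  assumes "\<And>i. i \<in> S \<Longrightarrow> y i \<noteq> p" "\<And>i. i \<in> S \<Longrightarrow> y i \<noteq> q" "p \<noteq> q"
  shows "(\<Sum>i\<in>S. 1 / ((p - y i)\<^sup>2 * (y i - q))) =
    (\<Sum>i\<in>S. 1 / (p - y i)\<^sup>2) / (p - q)
    + (pole_sum S y p - pole_sum S y q) / (p - q)\<^sup>2"
proof -
  have "1 / ((p - y i)\<^sup>2 * (y i - q)) =
      1 / (p - y i)\<^sup>2 / (p - q) + (1 / (p - y i) - 1 / (q - y i)) / (p - q)\<^sup>2" if "i \<in> S" for i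
  proof -
    define a b where "a = p - y i" and "b = y i - q"
    have nz: "a \<noteq> 0" "b \<noteq> 0" "a + b \<noteq> 0" using assms that by (auto simp: a_def b_def)
    have *: "1 / (a\<^sup>2 * b) = 1 / a\<^sup>2 / (a + b) + (1 / a - 1 / (- b)) / (a + b)\<^sup>2"
      using nz by (simp add: divide_simps) (simp add: algebra_simps power2_eq_square)
    have "a + b = p - q" "- b = q - y i" by (auto simp: a_def b_def)
    with * show ?thesis by (simp add: a_def b_def)
  qed
  then have "(\<Sum>i\<in>S. 1 / ((p - y i)\<^sup>2 * (y i - q))) =
      (\<Sum>i\<in>S. 1 / (p - y i)\<^sup>2 / (p - q) + (1 / (p - y i) - 1 / (q - y i)) / (p - q)\<^sup>2)"
    by (rule sum.cong[OF refl])
  then show ?thesis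
    by (simp only: sum.distrib sum_subtractf flip: sum_divide_distrib)
qed

text \<open>Pairing the terms \<open>(i, k)\<close> and \<open>(k, i)\<close> of the double sum
  removes the factor \<open>1 / (y i - y k)\<close> and leaves the off-diagonal part of the product
  on the right; the cubes are the diagonal of that product. The induction does this one point at a
  time.\<close>

lemma sum_double_pole_differences:
  fixes y :: "'i \<Rightarrow> 'a::field"
  assumes "finite S" "inj_on y S" "\<And>i. i \<in> S \<Longrightarrow> y i \<noteq> p"
  shows "(\<Sum>i\<in>S. pole_sum (S - {i}) y (y i) / (p - y i)\<^sup>2) =
    pole_sum S y p * (\<Sum>i\<in>S. 1 / (p - y i)\<^sup>2) - (\<Sum>i\<in>S. 1 / (p - y i) ^ 3)"
  using assms
proof (induction S rule: finite_induct)
  case (insert r S)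
  have r: "p - y r \<noteq> 0" "r \<notin> S" using insert by auto
  have ne: "y i \<noteq> y r" if "i \<in> S" for i
    using insert that by (auto simp: inj_on_def)
  have ins: "pole_sum (insert r S - {i}) y (y i) = 1 / (y i - y r) + pole_sum (S - {i}) y (y i)"
    if "i \<in> S" for i
  proof -
    have "insert r S - {i} = insert r (S - {i})" using that r by auto
    then show ?thesis using insert r by simp
  qed
  have "(\<Sum>i\<in>S. pole_sum (insert r S - {i}) y (y i) / (p - y i)\<^sup>2) =
     (\<Sum>i\<in>S. 1 / ((p - y i)\<^sup>2 * (y i - y r)) + pole_sum (S - {i}) y (y i) / (p - y i)\<^sup>2)"
    by (intro sum.cong refl) (simp add: ins add_divide_distrib mult.commute)
  also have "\<dots> = (\<Sum>i\<in>S. 1 / (p - y i)\<^sup>2) / (p - y r)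
    + (pole_sum S y p - pole_sum S y (y r)) / (p - y r)\<^sup>2
    + (pole_sum S y p * (\<Sum>i\<in>S. 1 / (p - y i)\<^sup>2) - (\<Sum>i\<in>S. 1 / (p - y i) ^ 3))"
    using insert ne r
    by (simp add: sum.distrib sum_double_pole_simple_pole)
  finally have *: "(\<Sum>i\<in>S. pole_sum (insert r S - {i}) y (y i) / (p - y i)\<^sup>2) = \<dots>" .
  \<comment> \<open>Here \<open>a\<close> is \<open>p - y r\<close> and \<open>M\<close> is the pole
    sum over \<open>S\<close> at \<open>y r\<close>. \<open>M\<close> enters once through the new
    summand \<open>i = r\<close> and once, with opposite sign, through the partial fractions with
    \<open>q = y r\<close>, and cancels.\<close>
  have alg: "M / a\<^sup>2 + (S2 / a + (S1 - M) / a\<^sup>2 + (S1 * S2 - S3)) =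
      (1 / a + S1) * (1 / a\<^sup>2 + S2) - (1 / a ^ 3 + S3)" for M a S1 S2 S3 :: 'a
    by (simp add: algebra_simps add_divide_distrib diff_divide_distrib power3_eq_cube power2_eq_square)
  have "insert r S - {r} = S" using r by auto
  then show ?case
    using insert(1,2) * alg by simp
qed simp

text \<open>Taking the pole at \<open>y j\<close> out of \<open>A k\<close> leaves one copy of the
  cubes and a pole sum over \<open>S - {j}\<close>. The previous identity with
  \<open>p = y j\<close> turns the latter into a second copy and a multiple of \<open>A j\<close>
  that cancels.\<close>

lemma sum_differences_cube:
  fixes y :: "'i \<Rightarrow> 'a::field"
  assumes "finite S" "inj_on y S" "j \<in> S"
  defines "A \<equiv> \<lambda>i. pole_sum (S - {i}) y (y i)"
  shows "(\<Sum>k\<in>S - {j}. (A j - A k) / (y j - y k)\<^sup>2) = (\<Sum>k\<in>S - {j}. 2 / (y j - y k) ^ 3)"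
proof -
  let ?R = "S - {j}"
  have ne: "y k \<noteq> y j" if "k \<in> ?R" for k
    using assms that by (auto simp: inj_on_def)
  have A: "A k = pole_sum (?R - {k}) y (y k) - 1 / (y j - y k)" if "k \<in> ?R" for k
  proof -
    have "S - {k} = insert j (?R - {k})" using that assms by auto
    then have "A k = 1 / (y k - y j) + pole_sum (?R - {k}) y (y k)"
      using assms by (simp add: A_def)
    also have "1 / (y k - y j) = - (1 / (y j - y k))"
      by (metis minus_diff_eq minus_divide_right)
    finally show ?thesis by simp
  qed
  have "(\<Sum>k\<in>?R. (A j - A k) / (y j - y k)\<^sup>2) =
    (\<Sum>k\<in>?R. A j * (1 / (y j - y k)\<^sup>2) - pole_sum (?R - {k}) y (y k) / (y j - y k)\<^sup>2
       + 1 / (y j - y k) ^ 3)"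
    by (intro sum.cong refl) (simp add: A diff_divide_distrib power3_eq_cube power2_eq_square)
  also have "\<dots> = A j * (\<Sum>k\<in>?R. 1 / (y j - y k)\<^sup>2)
     - (A j * (\<Sum>k\<in>?R. 1 / (y j - y k)\<^sup>2) - (\<Sum>k\<in>?R. 1 / (y j - y k) ^ 3))
     + (\<Sum>k\<in>?R. 1 / (y j - y k) ^ 3)"
    unfolding sum.distrib sum_subtractf
    using assms ne by (subst sum_double_pole_differences) (auto simp: sum_distrib_left inj_on_diff)
  finally show ?thesis by (simp flip: sum_distrib_left sum.distrib)
qed

section \<open>Tools for two coupled families: derivatives, a linear equation, the interaction
  identity\<close>

lemma has_vector_derivative_recip_diff:
  fixes f h :: "real \<Rightarrow> complex"
  assumes "(f has_vector_derivative f') (at t within S)" "(h has_vector_derivative h') (at t within S)"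
    and "f t \<noteq> h t"
  shows "((\<lambda>s. 1 / (f s - h s)) has_vector_derivative - ((f' - h') / (f t - h t)\<^sup>2)) (at t within S)"
proof -
  have "((\<lambda>w. 1 / w) has_field_derivative - (1 / (f t - h t)\<^sup>2)) (at (f t - h t) within (\<lambda>s. f s - h s) ` S)"
    using assms(3) by (auto intro!: derivative_eq_intros simp: power2_eq_square)
  from field_vector_diff_chain_within[OF has_vector_derivative_diff[OF assms(1,2)] this]
  show ?thesis by (simp add: o_def)
qed

text \<open>With \<open>I\<close> a primitive of \<open>c\<close>, the integrating factor
  \<open>exp (- I)\<close> makes \<open>E * exp (- I)\<close> constant, hence equal to its initial
  value zero.\<close>

lemma linear_ode_zero:
  fixes E c :: "real \<Rightarrow> complex"
  assumes "\<And>s. s \<in> {0..t} \<Longrightarrow> (E has_vector_derivative c s * E s) (at s within {0..t})"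
    and "continuous_on {0..t} c" "E 0 = 0" "t \<ge> 0"
  shows "E t = 0"
proof -
  define I where "I = (\<lambda>s. integral {0..s} c)"
  have I: "(I has_vector_derivative c s) (at s within {0..t})" if "s \<in> {0..t}" for s
    unfolding I_def by (rule integral_has_vector_derivative) (use assms that in auto)
  have X: "((\<lambda>s. exp (- I s)) has_vector_derivative - c s * exp (- I s)) (at s within {0..t})" if "s \<in> {0..t}" for s
  proof -
    have "(exp has_field_derivative exp (- I s)) (at (- I s) within (\<lambda>s. - I s) ` {0..t})"
      by (auto intro!: derivative_eq_intros)
    from field_vector_diff_chain_within[OF has_vector_derivative_minus[OF I[OF that]] this]
    show ?thesis by (simp add: o_def)
  qed
  have "((\<lambda>s. E s * exp (- I s)) has_vector_derivative 0) (at s within {0..t})" if "s \<in> {0..t}" for s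
    using has_vector_derivative_mult[OF assms(1)[OF that] X[OF that]] by (simp add: algebra_simps)
  then obtain C where C: "\<And>s. s \<in> {0..t} \<Longrightarrow> E s * exp (- I s) = C"
    using has_vector_derivative_zero_constant[OF convex_real_interval(5)] by blast
  have "E t * exp (- I t) = E 0 * exp (- I 0)"
    using C[of t] C[of 0] assms(4) by simp
  then show ?thesis using assms(3) by simp
qed

text \<open>The term \<open>m = l\<close> of the mutual pole sum and the self-interaction of the
  \<open>x j\<close> produce the same sum of cubes, which cancels in the difference. The terms
  \<open>m \<noteq> l\<close> are partial fractions with \<open>p = z l\<close> and
  \<open>q = z m\<close>. Both families are arbitrary, so their roles may be exchanged.\<close>

lemma sum_double_pole_interaction:
  fixes x :: "'i \<Rightarrow> 'a::field" and z :: "'k \<Rightarrow> 'a"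
  assumes fin: "finite J" "finite L" and inj: "inj_on x J" "inj_on z L"
    and disj: "\<And>i k. i \<in> J \<Longrightarrow> k \<in> L \<Longrightarrow> x i \<noteq> z k" and l: "l \<in> L"
  shows "(\<Sum>j\<in>J. (pole_sum L z (x j) - pole_sum (J - {j}) x (x j)) / (z l - x j)\<^sup>2) =
    (pole_sum (L - {l}) z (z l) - pole_sum J x (z l)) * (\<Sum>j\<in>J. 1 / (z l - x j)\<^sup>2)
    + (\<Sum>m\<in>L - {l}. (pole_sum J x (z l) - pole_sum J x (z m)) / (z l - z m)\<^sup>2)"
proof -
  let ?S2 = "\<Sum>j\<in>J. 1 / (z l - x j)\<^sup>2" and ?S3 = "\<Sum>j\<in>J. 1 / (z l - x j) ^ 3"
  have "pole_sum L z (x j) / (z l - x j)\<^sup>2 =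
      (\<Sum>m\<in>L - {l}. 1 / ((z l - x j)\<^sup>2 * (x j - z m))) - 1 / (z l - x j) ^ 3" if "j \<in> J" for j
  proof -
    have "pole_sum L z (x j) = 1 / (x j - z l) + pole_sum (L - {l}) z (x j)"
      using l fin by (simp add: sum.remove)
    also have "1 / (x j - z l) = - (1 / (z l - x j))"
      by (metis minus_diff_eq minus_divide_right)
    finally show ?thesis
      by (simp add: sum_divide_distrib diff_divide_distrib power3_eq_cube power2_eq_square mult.commute)
  qed
  then have "(\<Sum>j\<in>J. pole_sum L z (x j) / (z l - x j)\<^sup>2) =
      (\<Sum>m\<in>L - {l}. \<Sum>j\<in>J. 1 / ((z l - x j)\<^sup>2 * (x j - z m))) - ?S3"
    by (subst sum.swap) (simp add: sum_subtractf)
  also have "(\<Sum>m\<in>L - {l}. \<Sum>j\<in>J. 1 / ((z l - x j)\<^sup>2 * (x j - z m))) =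
      (\<Sum>m\<in>L - {l}. ?S2 * (1 / (z l - z m)) +
         (pole_sum J x (z l) - pole_sum J x (z m)) / (z l - z m)\<^sup>2)"
    using disj l inj(2)
    by (intro sum.cong refl) (subst sum_double_pole_simple_pole, auto simp: inj_on_def)
  finally have B: "(\<Sum>j\<in>J. pole_sum L z (x j) / (z l - x j)\<^sup>2) =
      ?S2 * pole_sum (L - {l}) z (z l)
      + (\<Sum>m\<in>L - {l}. (pole_sum J x (z l) - pole_sum J x (z m)) / (z l - z m)\<^sup>2) - ?S3"
    unfolding sum.distrib sum_distrib_left[symmetric] .
  have "(\<Sum>j\<in>J. pole_sum (J - {j}) x (x j) / (z l - x j)\<^sup>2) = pole_sum J x (z l) * ?S2 - ?S3"
    using fin inj disj l by (intro sum_double_pole_differences) auto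
  moreover have "(\<Sum>j\<in>J. (pole_sum L z (x j) - pole_sum (J - {j}) x (x j)) / (z l - x j)\<^sup>2) =
      (\<Sum>j\<in>J. pole_sum L z (x j) / (z l - x j)\<^sup>2)
      - (\<Sum>j\<in>J. pole_sum (J - {j}) x (x j) / (z l - x j)\<^sup>2)"
    unfolding sum_subtractf[symmetric] diff_divide_distrib ..
  ultimately show ?thesis
    unfolding B by (simp add: left_diff_distrib right_diff_distrib mult.commute)
qed

lemma has_vector_derivative_pole_sum:
  fixes y :: "'i \<Rightarrow> real \<Rightarrow> complex"
  assumes "\<And>i. i \<in> I \<Longrightarrow> (y i has_vector_derivative y' i) (at t within S)"
    and "(w has_vector_derivative w') (at t within S)" "\<And>i. i \<in> I \<Longrightarrow> w t \<noteq> y i t"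
  shows "((\<lambda>s. pole_sum I (\<lambda>i. y i s) (w s)) has_vector_derivative
           - (\<Sum>i\<in>I. (w' - y' i) / (w t - y i t)\<^sup>2)) (at t within S)"
  unfolding sum_negf[symmetric]
  by (intro has_vector_derivative_sum has_vector_derivative_recip_diff assms)

section \<open>Derivatives of the stationary defect and of the velocity at one instant\<close>

context
  fixes J :: "'i set" and L :: "'k set" and X :: "'i \<Rightarrow> real \<Rightarrow> complex" and Z :: "'k \<Rightarrow> real \<Rightarrow> complex"
    and S :: "real set" and t :: real
  assumes fin: "finite J" "finite L"
    and inj: "inj_on (\<lambda>j. X j t) J" "inj_on (\<lambda>l. Z l t) L"
    and disj: "\<And>j l. j \<in> J \<Longrightarrow> l \<in> L \<Longrightarrow> X j t \<noteq> Z l t"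
    and X': "\<And>j. j \<in> J \<Longrightarrow> (X j has_vector_derivative
        pole_sum (J - {j}) (\<lambda>i. X i t) (X j t) - pole_sum L (\<lambda>l. Z l t) (X j t)) (at t within S)"
    and Z': "\<And>l. l \<in> L \<Longrightarrow> (Z l has_vector_derivative
        pole_sum J (\<lambda>j. X j t) (Z l t) / 2) (at t within S)"
begin

lemma disj_sym: "Z l t \<noteq> X j t" if "j \<in> J" "l \<in> L"
  using disj[OF that] by simp

text \<open>The differences \<open>C l - C m\<close> arise from the interaction identity and from
  differentiating the second pole sum. The factor 2 in \<open>E\<close> compensates the speed 1/2 of
  the \<open>Z l\<close>, so these differences cancel and only a multiple of \<open>E\<close> itself
  remains.\<close>

lemma stationary_defect_derivative:
  assumes l: "l \<in> L"
  defines "E \<equiv> \<lambda>s. pole_sum J (\<lambda>j. X j s) (Z l s) - 2 * pole_sum (L - {l}) (\<lambda>m. Z m s) (Z l s)"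
  shows "(E has_vector_derivative (\<Sum>j\<in>J. 1 / (Z l t - X j t)\<^sup>2) / 2 * E t) (at t within S)"
proof -
  let ?A = "\<lambda>j. pole_sum (J - {j}) (\<lambda>i. X i t) (X j t)" and ?B = "\<lambda>j. pole_sum L (\<lambda>l. Z l t) (X j t)"
    and ?C = "\<lambda>l. pole_sum J (\<lambda>j. X j t) (Z l t)" and ?D = "pole_sum (L - {l}) (\<lambda>m. Z m t) (Z l t)"
    and ?S2 = "\<Sum>j\<in>J. 1 / (Z l t - X j t)\<^sup>2"
  have half: "2 * ((a / 2 - b / 2) / c) = (a - b) / c" for a b c :: complex
    by (simp add: diff_divide_distrib right_diff_distrib)
  let ?W = "\<Sum>m\<in>L - {l}. (?C l - ?C m) / (Z l t - Z m t)\<^sup>2"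
  let ?F = "\<Sum>j\<in>J. (?C l / 2 - (?A j - ?B j)) / (Z l t - X j t)\<^sup>2"
    and ?G = "\<Sum>m\<in>L - {l}. (?C l / 2 - ?C m / 2) / (Z l t - Z m t)\<^sup>2"
  have "(E has_vector_derivative - ?F - 2 * - ?G) (at t within S)"
    unfolding E_def using inj disj l
    by (intro has_vector_derivative_diff has_vector_derivative_mult_right
          has_vector_derivative_pole_sum X' Z') (auto simp: inj_on_def disj_sym)
  moreover have "- ?F - 2 * - ?G = ?S2 / 2 * E t"
  proof -
    have G: "2 * ?G = ?W"
      unfolding sum_distrib_left by (intro sum.cong refl) (simp only: half)
    have "?F = ?C l / 2 * ?S2 + (\<Sum>j\<in>J. (?B j - ?A j) / (Z l t - X j t)\<^sup>2)"
      unfolding sum_distrib_left sum.distrib[symmetric]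
      by (intro sum.cong refl) (simp add: diff_divide_distrib add_divide_distrib)
    also have "(\<Sum>j\<in>J. (?B j - ?A j) / (Z l t - X j t)\<^sup>2) = (?D - ?C l) * ?S2 + ?W"
      using fin inj disj l by (intro sum_double_pole_interaction) auto
    finally have F: "?F = ?C l / 2 * ?S2 + ((?D - ?C l) * ?S2 + ?W)" .
    have alg: "- f - 2 * - g = s / 2 * (c - 2 * d)"
      if "2 * g = w" "f = c / 2 * s + ((d - c) * s + w)" for c d f g s w :: complex
      using that by (simp add: field_simps)
    show ?thesis
      unfolding E_def by (rule alg[OF G F])
  qed
  ultimately show ?thesis
    by (simp only:)
qed

text \<open>The differences \<open>A j - A k\<close> give the cubes. The differences
  \<open>B j - B k\<close> give a mixed sum \<open>W\<close>, which the motion relative to the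
  points \<open>Z l\<close> reproduces with the opposite sign, thanks to stationarity.\<close>

lemma velocity_derivative:
  assumes j: "j \<in> J"
    and stat: "\<And>l. l \<in> L \<Longrightarrow>
      pole_sum J (\<lambda>j. X j t) (Z l t) = 2 * pole_sum (L - {l}) (\<lambda>m. Z m t) (Z l t)"
  shows "((\<lambda>s. pole_sum (J - {j}) (\<lambda>i. X i s) (X j s) - pole_sum L (\<lambda>l. Z l s) (X j s))
     has_vector_derivative - (\<Sum>k\<in>J - {j}. 2 / (X j t - X k t) ^ 3)) (at t within S)"
proof -
  let ?A = "\<lambda>j. pole_sum (J - {j}) (\<lambda>i. X i t) (X j t)" and ?B = "\<lambda>j. pole_sum L (\<lambda>l. Z l t) (X j t)"
    and ?C = "\<lambda>l. pole_sum J (\<lambda>j. X j t) (Z l t)" and ?D = "\<lambda>l. pole_sum (L - {l}) (\<lambda>m. Z m t) (Z l t)"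
    and ?P2 = "\<Sum>l\<in>L. 1 / (X j t - Z l t)\<^sup>2"
  have regroup: "((a - b) - (c - d)) / e = (a - c) / e - (b - d) / e" for a b c d e :: complex
    by (simp flip: diff_divide_distrib)
  let ?W = "\<Sum>k\<in>J - {j}. (?B j - ?B k) / (X j t - X k t)\<^sup>2"
  let ?F = "\<Sum>k\<in>J - {j}. ((?A j - ?B j) - (?A k - ?B k)) / (X j t - X k t)\<^sup>2"
    and ?G = "\<Sum>l\<in>L. ((?A j - ?B j) - ?C l / 2) / (X j t - Z l t)\<^sup>2"
    and ?R = "\<Sum>k\<in>J - {j}. 2 / (X j t - X k t) ^ 3"
  have "((\<lambda>s. pole_sum (J - {j}) (\<lambda>i. X i s) (X j s) - pole_sum L (\<lambda>l. Z l s) (X j s))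
     has_vector_derivative - ?F - - ?G) (at t within S)"
    using inj disj j
    by (intro has_vector_derivative_diff has_vector_derivative_pole_sum X' Z') (auto simp: inj_on_def disj disj_sym)
  moreover have "- ?F - - ?G = - ?R"
  proof -
    have "?F = (\<Sum>k\<in>J - {j}. (?A j - ?A k) / (X j t - X k t)\<^sup>2) - ?W"
      by (simp only: regroup sum_subtractf)
    also have "(\<Sum>k\<in>J - {j}. (?A j - ?A k) / (X j t - X k t)\<^sup>2) = ?R"
      using fin inj j by (intro sum_differences_cube) auto
    finally have F: "?F = ?R - ?W" .
    \<comment> \<open>By stationarity \<open>C/2 = C - D\<close>, which is the expression to which the identity applies
      with the roles of \<open>X\<close> and \<open>Z\<close> exchanged.\<close>
    have "?G = (?A j - ?B j) * ?P2 - (\<Sum>l\<in>L. (?C l - ?D l) / (X j t - Z l t)\<^sup>2)"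
      unfolding sum_distrib_left sum_subtractf[symmetric]
      by (intro sum.cong refl) (simp add: stat diff_divide_distrib)
    also have "(\<Sum>l\<in>L. (?C l - ?D l) / (X j t - Z l t)\<^sup>2) = (?A j - ?B j) * ?P2 + ?W"
      using fin inj disj j by (intro sum_double_pole_interaction) (auto simp: disj_sym)
    finally have G: "?G = (?A j - ?B j) * ?P2 - ((?A j - ?B j) * ?P2 + ?W)" .
    have alg: "- f - - g = - r" if "f = r - w" "g = u - (u + w)" for f g r u w :: complex
      using that by simp
    show ?thesis by (rule alg[OF F G])
  qed
  ultimately show ?thesis
    by (simp only:)
qed

end

section \<open>Application to the superposition of the processes\<close>

theorem theorem2p9:
  fixes n :: nat
    and x0 :: "nat \<Rightarrow> real"
    and \<zeta> :: "nat \<Rightarrow> sphere"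
    and T :: real
    and x :: "nat \<Rightarrow> real \<Rightarrow> real"
    and g :: "real \<Rightarrow> complex \<Rightarrow> complex"
  assumes "n \<ge> 1"
    and "inj_on x0 {1..2*n}"
    and "inj_on \<zeta> {1..n+1}"
    and "\<forall>j\<in>{1..2*n}. \<forall>k\<in>{1..n+1}. \<zeta> k \<noteq> Some (of_real (x0 j))"
    and "map_option cnj ` (\<zeta> ` {1..n+1}) = \<zeta> ` {1..n+1}"
    and "\<forall>k\<in>{1..n+1}. (\<Sum>j\<in>{1..2*n}. sfrac 1 (\<zeta> k) (Some (of_real (x0 j))))
                     = (\<Sum>l\<in>{1..n+1} - {k}. sfrac 2 (\<zeta> k) (\<zeta> l))"
    and "sle0_superposition {1..2*n} {1..n+1} (\<lambda>j. 1/4) x0 \<zeta> (\<lambda>j k. 2) (\<lambda>j k. -4) T x g"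
    and "no_collision_before {1..2*n} {1..n+1} (\<lambda>j. 1/4) \<zeta> T x g"
  shows "\<exists>v :: nat \<Rightarrow> real \<Rightarrow> real. \<forall>j\<in>{1..2*n}. \<forall>t\<in>{0..<T}.
           (x j has_real_derivative v j t) (at t within {0..<T}) \<and>
           (v j has_real_derivative - (\<Sum>k\<in>{1..2*n} - {j}. 2 / (x j t - x k t) ^ 3))
             (at t within {0..<T})"
proof -
  define S where "S = {0..<T}"
  define J where "J = {1..2 * n}"
  \<comment> \<open>Fractions involving infinity vanish, so all sums can be restricted to the
    indices of finite points; on these \<open>the (\<zeta> k)\<close> is meaningful.\<close>
  define L where "L = {k \<in> {1..n + 1}. \<zeta> k \<noteq> None}"
  define X where "X = (\<lambda>j s. complex_of_real (x j s))"
  define Z where "Z = (\<lambda>k s. g s (the (\<zeta> k)))"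
  note superposition = assms(7)[unfolded sle0_superposition_def loewner_chain_def, folded J_def S_def]
  note chain = superposition[THEN conjunct1, rule_format]
    and start = superposition[THEN conjunct2, THEN conjunct1, rule_format]
    and drive = superposition[THEN conjunct2, THEN conjunct2, rule_format]
  have fin: "finite J" "finite L" by (simp_all add: J_def L_def)
  have \<zeta>: "\<zeta> k = Some (the (\<zeta> k))" "k \<in> {1..n + 1}" if "k \<in> L" for k
    using that by (auto simp: L_def)
  have gZ: "map_option (g t) (\<zeta> k) = Some (Z k t)" if "k \<in> L" for k t
    using \<zeta>(1)[OF that] by (metis Z_def option.simps(9))

  have injX: "inj_on (\<lambda>j. X j t) J" and injZ: "inj_on (\<lambda>k. Z k t) L"
    and disj: "\<And>j k. j \<in> J \<Longrightarrow> k \<in> L \<Longrightarrow> X j t \<noteq> Z k t"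
    and alive: "\<And>k. k \<in> L \<Longrightarrow> the (\<zeta> k) \<notin> loewner_hull J (\<lambda>j. 1/4) x t" if "t \<in> S" for t
  proof -
    note no_collision = assms(8)[unfolded no_collision_before_def, folded J_def S_def,
        THEN bspec, OF that]
    note injx = no_collision[THEN conjunct1]
      and not_swallowed = no_collision[THEN conjunct2, THEN conjunct1, rule_format]
      and injg = no_collision[THEN conjunct2, THEN conjunct2, THEN conjunct1]
      and disjg = no_collision[THEN conjunct2, THEN conjunct2, THEN conjunct2, rule_format]
    show "inj_on (\<lambda>j. X j t) J"
      using injx by (simp add: X_def inj_on_def)
    show "inj_on (\<lambda>k. Z k t) L"
    proof (rule inj_onI)
      fix k l assume kl: "k \<in> L" "l \<in> L" "Z k t = Z l t"
      then have "map_option (g t) (\<zeta> k) = map_option (g t) (\<zeta> l)"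
        by (simp only: gZ)
      from inj_onD[OF injg this] show "k = l" using \<zeta>(2) kl(1,2) by simp
    qed
    show "X j t \<noteq> Z k t" if "j \<in> J" "k \<in> L" for j k
      using disjg[OF that(1) \<zeta>(2)[OF that(2)]] unfolding gZ[OF that(2)] X_def by (metis)
    show "the (\<zeta> k) \<notin> loewner_hull J (\<lambda>j. 1/4) x t" if "k \<in> L" for k
      using \<zeta>[OF that] by (intro not_swallowed)
  qed
  have disj_sym: "Z k t \<noteq> X j t" if "t \<in> S" "j \<in> J" "k \<in> L" for t j k
    using disj[OF that] by simp

  have traj: "loewner_trajectory J (\<lambda>j. 1/4) x (the (\<zeta> k)) t (Z k)" if "t \<in> S" "k \<in> L" for t k
    unfolding Z_def by (rule chain[OF that(1) alive[OF that]])
  have Z': "(Z k has_vector_derivative pole_sum J (\<lambda>j. X j t) (Z k t) / 2) (at t within S)"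
    if "t \<in> S" "k \<in> L" for t k
  proof -
    \<comment> \<open>A trajectory up to \<open>t\<close> only yields a derivative from the left.
      Running it to a later time \<open>t' < T\<close> makes \<open>{0..t'}\<close> agree with
      \<open>S\<close> near \<open>t\<close>, so the derivative within \<open>S\<close>
      follows.\<close>
    define t' where "t' = (t + T) / 2"
    have t': "0 \<le> t" "t < t'" "t' < T" using that by (auto simp: S_def t'_def)
    then have "loewner_trajectory J (\<lambda>j. 1/4) x (the (\<zeta> k)) t' (Z k)"
      using that by (intro traj) (auto simp: S_def)
    then have "(Z k has_vector_derivative
        (\<Sum>j\<in>J. of_real (2 * (1/4)) / (Z k t - of_real (x j t)))) (at t within {0..t'})"
      unfolding loewner_trajectory_def using t'(1,2) by simp
    moreover have "at t within {0..t'} = at t within S"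
    proof (rule at_within_nhd)
      show "t \<in> {..<t'}" "open {..<t'}" using t'(2) by simp_all
      have "s \<in> {0..t'} \<longleftrightarrow> s \<in> S" if "s < t'" for s
        using t'(3) that by (simp add: S_def)
      then show "{0..t'} \<inter> {..<t'} - {t} = S \<inter> {..<t'} - {t}"
        by blast
    qed
    moreover have "(\<Sum>j\<in>J. of_real (2 * (1/4)) / (Z k t - of_real (x j t))) =
        pole_sum J (\<lambda>j. X j t) (Z k t) / 2"
      unfolding sum_divide_distrib X_def by (intro sum.cong refl) simp
    ultimately show ?thesis by (simp only:)
  qed

  have X': "(X j has_vector_derivative
      pole_sum (J - {j}) (\<lambda>i. X i t) (X j t) - pole_sum L (\<lambda>k. Z k t) (X j t)) (at t within S)"
    if "t \<in> S" "j \<in> J" for t j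
  proof -
    let ?A = "pole_sum (J - {j}) (\<lambda>i. X i t) (X j t)" and ?B = "pole_sum L (\<lambda>k. Z k t) (X j t)"
    have "(\<Sum>k\<in>{1..n + 1}. sfrac (of_real (-4)) (Some (X j t)) (map_option (g t) (\<zeta> k))) =
        (\<Sum>k\<in>L. - 4 * (1 / (X j t - Z k t)))"
      by (intro sum.mono_neutral_cong_right) (auto simp: L_def Z_def)
    moreover have "(\<Sum>k\<in>J - {j}. of_real 2 / (X j t - X k t)) = 2 * ?A"
      unfolding sum_distrib_left by (intro sum.cong refl) simp
    moreover have "(\<Sum>k\<in>J - {j}. of_real (2 * (1/4)) / (X j t - X k t)) = ?A / 2"
      unfolding sum_divide_distrib by (intro sum.cong refl) simp
    \<comment> \<open>The weights combine here: \<open>A\<close> gets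
      \<open>1/4 * 2 + 1/2 = 1\<close> and \<open>B\<close> gets
      \<open>1/4 * (-4) = -1\<close>.\<close>
    moreover have "of_real (1/4) * (2 * a + - 4 * b) + a / 2 = a - b" for a b :: complex
      by (simp add: field_simps)
    ultimately have "of_real (1/4) *
         ((\<Sum>k\<in>J - {j}. of_real 2 / (X j t - X k t)) +
          (\<Sum>k\<in>{1..n + 1}. sfrac (of_real (-4)) (Some (X j t)) (map_option (g t) (\<zeta> k)))) +
         (\<Sum>k\<in>J - {j}. of_real (2 * (1/4)) / (X j t - X k t)) = ?A - ?B"
      by (simp only: sum_distrib_left[symmetric])
    moreover have "(X j has_vector_derivative of_real (1/4) *
         ((\<Sum>k\<in>J - {j}. of_real 2 / (X j t - X k t)) +
          (\<Sum>k\<in>{1..n + 1}. sfrac (of_real (-4)) (Some (X j t)) (map_option (g t) (\<zeta> k)))) +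
         (\<Sum>k\<in>J - {j}. of_real (2 * (1/4)) / (X j t - X k t))) (at t within S)"
      unfolding X_def by (rule drive[OF that(2,1)])
    ultimately show ?thesis by (simp only:)
  qed

  define E where "E = (\<lambda>k s. pole_sum J (\<lambda>j. X j s) (Z k s)
    - 2 * pole_sum (L - {k}) (\<lambda>m. Z m s) (Z k s))"
  have E0: "E k 0 = 0" if "k \<in> L" "0 \<in> S" for k
  proof -
    have X0: "X j 0 = of_real (x0 j)" if "j \<in> J" for j
      using start[OF that] by (simp add: X_def)
    \<comment> \<open>The initial condition is read off the trajectory surviving up to time 0; this
      identifies the \<open>Z l 0\<close> with the given points, for which stationarity is
      assumed.\<close>
    have Z0: "\<zeta> l = Some (Z l 0)" if "l \<in> L" for l
      using traj[OF \<open>0 \<in> S\<close> that] \<zeta>(1)[OF that] by (simp add: loewner_trajectory_def)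
    have "(\<Sum>j\<in>J. sfrac 1 (\<zeta> k) (Some (of_real (x0 j)))) = pole_sum J (\<lambda>j. X j 0) (Z k 0)"
      using X0 Z0[OF that(1)] by (intro sum.cong refl) simp
    moreover have "(\<Sum>l\<in>{1..n + 1} - {k}. sfrac 2 (\<zeta> k) (\<zeta> l)) =
        (\<Sum>l\<in>L - {k}. 2 * (1 / (Z k 0 - Z l 0)))"
    proof (rule sum.mono_neutral_cong_right)
      show "\<forall>l\<in>{1..n + 1} - {k} - (L - {k}). sfrac 2 (\<zeta> k) (\<zeta> l) = 0"
      proof
        fix l assume "l \<in> {1..n + 1} - {k} - (L - {k})"
        then have "\<zeta> l = None" by (auto simp: L_def simp del: not_None_eq)
        then show "sfrac 2 (\<zeta> k) (\<zeta> l) = 0"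
          unfolding Z0[OF that(1)] by simp
      qed
      show "sfrac 2 (\<zeta> k) (\<zeta> l) = 2 * (1 / (Z k 0 - Z l 0))" if "l \<in> L - {k}" for l
        using that Z0[of l] Z0[OF \<open>k \<in> L\<close>] by simp
    qed (auto simp: L_def)
    moreover have "(\<Sum>j\<in>J. sfrac 1 (\<zeta> k) (Some (of_real (x0 j)))) =
        (\<Sum>l\<in>{1..n + 1} - {k}. sfrac 2 (\<zeta> k) (\<zeta> l))"
      unfolding J_def by (rule bspec[OF assms(6) \<zeta>(2)[OF that(1)]])
    ultimately have "pole_sum J (\<lambda>j. X j 0) (Z k 0) = (\<Sum>l\<in>L - {k}. 2 * (1 / (Z k 0 - Z l 0)))"
      by (simp only:)
    then show ?thesis by (simp only: E_def sum_distrib_left diff_self)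
  qed
  \<comment> \<open>Stationarity propagates: the defect solves a scalar homogeneous linear equation
    from zero. Its coefficient is continuous because no \<open>Z k\<close> meets an
    \<open>X j\<close> before \<open>T\<close>.\<close>
  have stat: "E k t = 0" if "k \<in> L" "t \<in> S" for k t
  proof (rule linear_ode_zero)
    have sub: "{0..t} \<subseteq> S" using that by (auto simp: S_def)
    show "(E k has_vector_derivative (\<Sum>j\<in>J. 1 / (Z k s - X j s)\<^sup>2) / 2 * E k s) (at s within {0..t})"
      if "s \<in> {0..t}" for s
    proof (rule has_vector_derivative_within_subset[OF _ sub])
      have s: "s \<in> S" using that sub by blast
      show "(E k has_vector_derivative (\<Sum>j\<in>J. 1 / (Z k s - X j s)\<^sup>2) / 2 * E k s) (at s within S)"
        unfolding E_def
        by (rule stationary_defect_derivative[OF fin injX[OF s] injZ[OF s] disj[OF s] X'[OF s] Z'[OF s]])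
          (use \<open>k \<in> L\<close> in auto)
    qed
    have "continuous_on S (X j)" if "j \<in> J" for j
      using X' that by (auto intro!: continuous_on_vector_derivative)
    moreover have "continuous_on S (Z k)"
      using Z' \<open>k \<in> L\<close> by (auto intro!: continuous_on_vector_derivative)
    ultimately have "continuous_on S (\<lambda>s. (\<Sum>j\<in>J. 1 / (Z k s - X j s)\<^sup>2) / 2)"
      using disj_sym \<open>k \<in> L\<close> by (intro continuous_intros) auto
    then show "continuous_on {0..t} (\<lambda>s. (\<Sum>j\<in>J. 1 / (Z k s - X j s)\<^sup>2) / 2)"
      using sub by (rule continuous_on_subset)
    show "E k 0 = 0" "0 \<le> t"
      using that by (auto intro!: E0 simp: S_def)
  qed

  \<comment> \<open>The velocity is a complex expression, but it is the derivative of the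
    real-valued \<open>X j\<close>. Its real part therefore serves as the witness for
    \<open>v\<close>.\<close>
  define V where "V = (\<lambda>j s. pole_sum (J - {j}) (\<lambda>i. X i s) (X j s) - pole_sum L (\<lambda>k. Z k s) (X j s))"
  have velocity: "(x j has_real_derivative Re (V j t)) (at t within S)" if "j \<in> J" "t \<in> S" for j t
    using bounded_linear.has_vector_derivative[OF bounded_linear_Re X'[OF that(2,1)]]
    by (simp add: V_def X_def has_real_derivative_iff_has_vector_derivative)
  have acceleration: "((\<lambda>s. Re (V j s)) has_real_derivative - (\<Sum>k\<in>J - {j}. 2 / (x j t - x k t) ^ 3))
      (at t within S)" if j: "j \<in> J" and t: "t \<in> S" for j t
  proof -
    have "(V j has_vector_derivative - (\<Sum>k\<in>J - {j}. 2 / (X j t - X k t) ^ 3)) (at t within S)"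
      unfolding V_def
      by (rule velocity_derivative[OF fin injX[OF t] injZ[OF t] disj[OF t] X'[OF t] Z'[OF t] j])
        (use stat[OF _ t] in \<open>auto simp: E_def\<close>)
    also have "- (\<Sum>k\<in>J - {j}. 2 / (X j t - X k t) ^ 3) =
        of_real (- (\<Sum>k\<in>J - {j}. 2 / (x j t - x k t) ^ 3))"
      by (simp add: X_def)
    finally have "((\<lambda>s. Re (V j s)) has_vector_derivative
        Re (of_real (- (\<Sum>k\<in>J - {j}. 2 / (x j t - x k t) ^ 3)))) (at t within S)"
      by (rule bounded_linear.has_vector_derivative[OF bounded_linear_Re])
    then show ?thesis
      unfolding has_real_derivative_iff_has_vector_derivative Re_complex_of_real .
  qed
  show ?thesis
    unfolding J_def[symmetric] S_def[symmetric]
    by (intro exI[of _ "\<lambda>j s. Re (V j s)"] ballI conjI velocity acceleration)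
qed

end
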